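(* Let $\mathscr{A}$ be a unital C*-algebra. If $\varphi\in\mathsf{D}(\mathscr{A})$ and $H\in\mathscr{A}$ is self-adjoint, then there exist maps $L_1, L_2 \in B(\mathscr{A})$ satisfying the conditions (1) $L_1\in \mathrm{Dis}_\infty(\mathscr{A})$, (2) $L_2\in\mathsf{coCP}(\mathscr{A})$, (3) $L_1(\mathbf{1}) + L_2(\mathbf{1}) = 0$, such that $L = L_1 + L_2$ is of the form $$L(a) = i[H,a] + \varphi(a) - \frac{1}{2}\{\varphi(\mathbf{1}),a\}, \quad a\in\mathscr{A}.$$
   Context: $\mathbf{1}$ is the unit of the algebra, $[a,b]=ab-ba$, $\{a,b\}=ab+ba$, and $B(\mathscr{A})$ is the Banach space of bounded linear maps $\mathscr{A}\to\mathscr{A}$. $M_n(\mathscr{A})$ is the C*-algebra of $n\times n$ matrices over $\mathscr{A}$. For $T\in B(\mathscr{A})$ let $T_n=\mathrm{id}_n\otimes T$ on $M_n(\mathscr{A})$, i.e. $T_n([a_{ij}])=[T(a_{ij})]$. $T$ is completely positive, $T\in\mathsf{CP}(\mathscr{A})$, if $T_n$ is positive for all $n\in\mathbb{N}$. $T$ is completely copositive, $T\in\mathsf{coCP}(\mathscr{A})$, if for all $n\in\mathbb{N}$ the map $[a_{ij}]\mapsto[T(a_{ji})]$ on $M_n(\mathscr{A})$ is positive. $T$ is decomposable, $T\in\mathsf{D}(\mathscr{A})$, if $T=\phi_1+\phi_2$ with $\phi_1\in\mathsf{CP}(\mathscr{A})$, $\phi_2\in\mathsf{coCP}(\mathscr{A})$.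 For a unital *-algebra $\mathscr{X}$ (here $\mathscr X=M_n(\mathscr A)$) and bounded linear $T:\mathscr{X}\to\mathscr{X}$ the dissipation function is $D_T(x)=T(x^*x)-T(x^* )x-x^*T(x)$. $T\in\mathrm{Dis}(\mathscr{X})$ means $D_T(x)\geqslant 0$ for all $x\in\mathscr{X}$. $T\in\mathrm{Dis}_\infty(\mathscr{A})$ (complete dissipation property) means $T_n\in\mathrm{Dis}(M_n(\mathscr{A}))$ for all $n\in\mathbb{N}$. *)

theory Defs
  imports "HOL-Analysis.Analysis" "Jordan_Normal_Form.Matrix"
begin

(* Unital C*-algebras over the complex numbers. As usual the unit is assumed to be nonzero.
   The remaining laws of a complex vector space follow from those of the real vector space
   via scaleR_scaleC. *)
class unital_cstar_algebra = real_normed_algebra_1 + banach +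
  fixes scaleC :: "complex \<Rightarrow> 'a \<Rightarrow> 'a" (infixr \<open>*\<^sub>C\<close> 75)
    and star :: "'a \<Rightarrow> 'a"
  assumes scaleR_scaleC: "r *\<^sub>R x = complex_of_real r *\<^sub>C x"
    and scaleC_add_right: "c *\<^sub>C (x + y) = c *\<^sub>C x + c *\<^sub>C y"
    and scaleC_add_left: "(c + d) *\<^sub>C x = c *\<^sub>C x + d *\<^sub>C x"
    and scaleC_scaleC: "c *\<^sub>C (d *\<^sub>C x) = (c * d) *\<^sub>C x"
    and mult_scaleC_left: "(c *\<^sub>C x) * y = c *\<^sub>C (x * y)"
    and mult_scaleC_right: "x * (c *\<^sub>C y) = c *\<^sub>C (x * y)"
    and norm_scaleC: "norm (c *\<^sub>C x) = cmod c * norm x"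
    and star_star: "star (star x) = x"
    and star_add: "star (x + y) = star x + star y"
    and star_scaleC: "star (c *\<^sub>C x) = cnj c *\<^sub>C star x"
    and star_mult: "star (x * y) = star y * star x"
    and cstar_identity: "norm (star x * x) = (norm x)\<^sup>2"

instantiation complex :: unital_cstar_algebra
begin

definition scaleC_complex :: "complex \<Rightarrow> complex \<Rightarrow> complex" where
  "scaleC_complex c x = c * x"

definition star_complex :: "complex \<Rightarrow> complex" where
  "star_complex = cnj"

instance
  by standard
    (auto simp: scaleC_complex_def star_complex_def algebra_simps norm_mult power2_eq_square
       scaleR_conv_of_real)

end

definition selfadjoint :: "'a::unital_cstar_algebra \<Rightarrow> bool" where
  "selfadjoint a \<longleftrightarrow> star a = a"

definition commutator :: "'a::ring \<Rightarrow> 'a \<Rightarrow> 'a" where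
  "commutator a b = a * b - b * a"

definition anticommutator :: "'a::ring \<Rightarrow> 'a \<Rightarrow> 'a" where
  "anticommutator a b = a * b + b * a"

(* Bounded maps are complex linear; the library's bounded_linear is only real linear. *)
definition bounded_maps :: "('a::unital_cstar_algebra \<Rightarrow> 'a) set" where
  "bounded_maps = {T. bounded_linear T \<and> (\<forall>c x. T (c *\<^sub>C x) = c *\<^sub>C T x)}"

(* The algebra of n by n matrices over 'a has the carrier "carrier_mat n n"; the amplification
   of T is "map_mat T". The size n = 0 is allowed below, where every condition holds trivially. *)

definition star_mat :: "'a::unital_cstar_algebra mat \<Rightarrow> 'a mat" where
  "star_mat X = map_mat star (transpose_mat X)"

(* An element of a C*-algebra is positive if it is of the form y* y with y in the same algebra. *)
definition positive_mat :: "nat \<Rightarrow> 'a::unital_cstar_algebra mat \<Rightarrow> bool" where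
  "positive_mat n X \<longleftrightarrow> (\<exists>Y \<in> carrier_mat n n. X = star_mat Y * Y)"

definition positive_map :: "nat \<Rightarrow> ('a::unital_cstar_algebra mat \<Rightarrow> 'a mat) \<Rightarrow> bool" where
  "positive_map n S \<longleftrightarrow> (\<forall>X \<in> carrier_mat n n. positive_mat n X \<longrightarrow> positive_mat n (S X))"

definition CP :: "('a::unital_cstar_algebra \<Rightarrow> 'a) set" where
  "CP = {T \<in> bounded_maps. \<forall>n. positive_map n (map_mat T)}"

definition coCP :: "('a::unital_cstar_algebra \<Rightarrow> 'a) set" where
  "coCP = {T \<in> bounded_maps. \<forall>n. positive_map n (\<lambda>X. map_mat T (transpose_mat X))}"

definition decomposable :: "('a::unital_cstar_algebra \<Rightarrow> 'a) set" where
  "decomposable = {T \<in> bounded_maps. \<exists>\<phi>\<^sub>1 \<in> CP. \<exists>\<phi>\<^sub>2 \<in> coCP. \<forall>a. T a = \<phi>\<^sub>1 a + \<phi>\<^sub>2 a}"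

definition dissipation ::
  "('a::unital_cstar_algebra mat \<Rightarrow> 'a mat) \<Rightarrow> 'a mat \<Rightarrow> 'a mat" where
  "dissipation S X = S (star_mat X * X) - S (star_mat X) * X - star_mat X * S X"

definition dissipative_map :: "nat \<Rightarrow> ('a::unital_cstar_algebra mat \<Rightarrow> 'a mat) \<Rightarrow> bool" where
  "dissipative_map n S \<longleftrightarrow> (\<forall>X \<in> carrier_mat n n. positive_mat n (dissipation S X))"

definition Dis_infty :: "('a::unital_cstar_algebra \<Rightarrow> 'a) set" where
  "Dis_infty = {T \<in> bounded_maps. \<forall>n. dissipative_map n (map_mat T)}"

end

theory Submission
  imports Defs
begin

text \<open>
  Let \<open>\<phi> = \<phi>\<^sub>1 + \<phi>\<^sub>2\<close> with \<open>\<phi>\<^sub>1\<close> completely positive and \<open>\<phi>\<^sub>2\<close> completely copositive, and \<open>K = \<phi>(1)\<close>.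
  Take \<open>L\<^sub>2 = \<phi>\<^sub>2\<close> and \<open>L\<^sub>1(a) = g a + a g' + \<phi>\<^sub>1(a)\<close> with \<open>g = i H - K/2\<close> and \<open>g' = - i H - K/2\<close>. Then
  \<open>L\<^sub>1 + L\<^sub>2\<close> has the required form and \<open>L\<^sub>1(1) = - \<phi>\<^sub>2(1)\<close>. On matrices the dissipation of \<open>L\<^sub>1\<close> is
  \<open>(\<phi>\<^sub>1(X\<^sup>* X) - \<phi>\<^sub>1(X\<^sup>*) X - X\<^sup>* \<phi>\<^sub>1(X) + X\<^sup>* \<phi>\<^sub>1(1) X) + X\<^sup>* \<phi>\<^sub>2(1) X\<close>. The bracket is a
  compression of the image under \<open>\<phi>\<^sub>1\<close> of the positive \<open>2n\<times>2n\<close> matrix with blocks \<open>1\<close>, \<open>X\<close>, \<open>X\<^sup>*\<close>,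
  \<open>X\<^sup>* X\<close> (lemma \<open>positive_CP_dissipation\<close>), and the last term is positive because \<open>\<phi>\<^sub>2(1)\<close> is
  (lemma \<open>positive_coCP_sandwich\<close>).

  Positivity of an \<open>n\<times>n\<close> matrix means having the form \<open>Z\<^sup>* Z\<close> with \<open>Z\<close> again \<open>n\<times>n\<close>, whereas
  compressions and sums only produce \<open>V\<^sup>* V\<close> with rectangular \<open>V\<close>. So the analytic core is
  \<open>positive_gram_mat\<close>: every \<open>V\<^sup>* V\<close> has a square root. It is obtained from the binomial
  series of \<open>sqrt (1 - X)\<close> at \<open>X = 1 - t V\<^sup>* V\<close>, whose coefficients are absolutely summable, so that it
  is enough that the entries of the powers of \<open>X\<close> are bounded. For small \<open>t\<close> they are, because \<open>X\<close>
  contracts the algebra-valued inner product \<open>\<langle>w, w\<rangle> = \<Sum>i. w\<^sub>i\<^sup>* w\<^sub>i\<close> on columns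
  (\<open>gram_contraction\<close>). In this way no C*-norm on matrices is needed, only the order of the algebra
  itself.

  That order rests on the theorem that \<open>x\<^sup>* x\<close> is positive (\<open>positive_star_mult_self\<close>) and on
  monotonicity of the norm (\<open>norm_le_norm_add_positive\<close>). Both are proved with norms and the square
  root series in place of spectra: positivity of a selfadjoint \<open>a\<close> is expressed as
  \<open>norm (r - a) \<le> r\<close> for some \<open>r\<close>.
\<close>

section \<open>The binomial series of the square root\<close>

text \<open>The Taylor coefficients of \<open>sqrt (1 - x)\<close> at \<open>0\<close>.\<close>

definition sqrt_coeff :: "nat \<Rightarrow> real" where
  "sqrt_coeff k = (-1) ^ k * ((1/2) gchoose k)"

lemma sqrt_coeff_0 [simp]: "sqrt_coeff 0 = 1"
  by (simp add: sqrt_coeff_def)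

text \<open>All coefficients after the constant one have the same sign. Hence bounds on the partial sums
  are already bounds on the sums of absolute values, and the series converges absolutely even on
  the boundary \<open>norm h = 1\<close> of its disc of convergence.\<close>

lemma sqrt_coeff_Suc_nonpos: "sqrt_coeff (Suc k) \<le> 0"
proof -
  have "pochhammer (1/2 :: real) k \<ge> 0"
    by (intro pochhammer_nonneg) auto
  moreover have "sqrt_coeff (Suc k) = - (1/2) * pochhammer (1/2) k / fact (Suc k)"
    unfolding sqrt_coeff_def gbinomial_pochhammer pochhammer_rec
    by (simp add: power_mult_distrib[symmetric])
  ultimately show ?thesis
    by (simp add: divide_nonpos_pos)
qed

lemma sum_sqrt_coeff_nonneg: "(\<Sum>k\<le>n. sqrt_coeff k) \<ge> 0"
proof -
  have "(\<Sum>k\<le>n. sqrt_coeff k) = (-1) ^ n * ((1/2 - 1) gchoose n)"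
    using gbinomial_sum_lower_neg[of "1/2::real" n] by (simp add: sqrt_coeff_def mult.commute)
  also have "\<dots> = pochhammer (1/2) n / fact n"
    by (simp add: gbinomial_pochhammer power_mult_distrib[symmetric])
  also have "\<dots> \<ge> 0"
    by (intro divide_nonneg_pos pochhammer_nonneg) auto
  finally show ?thesis .
qed

text \<open>The coefficient form of \<open>sqrt (1 - x) * sqrt (1 - x) = 1 - x\<close>; it is Vandermonde's identity
  for the exponents \<open>1/2 + 1/2 = 1\<close>.\<close>

lemma sqrt_coeff_convolution:
  "(\<Sum>i\<le>k. sqrt_coeff i * sqrt_coeff (k - i)) = (if k = 0 then 1 else if k = 1 then -1 else 0)"
proof -
  have "(\<Sum>i\<le>k. sqrt_coeff i * sqrt_coeff (k - i))
      = (\<Sum>i\<le>k. (-1) ^ k * (((1/2) gchoose i) * ((1/2) gchoose (k - i))))"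
    by (intro sum.cong) (auto simp: sqrt_coeff_def power_add[symmetric])
  also have "\<dots> = (-1) ^ k * (1 gchoose k)"
    using gbinomial_Vandermonde[of "1/2::real" "1/2" k]
    by (simp add: sum_distrib_left[symmetric] atMost_atLeast0)
  also have "(1::real) gchoose k = of_nat (1 choose k)"
    by (simp add: binomial_gbinomial)
  finally show ?thesis
    by (cases k rule: nat.exhaust; cases "k - 1") auto
qed

lemma sum_minus_sqrt_coeff_Suc_le: "(\<Sum>k<n. - sqrt_coeff (Suc k)) \<le> 1"
  using sum_sqrt_coeff_nonneg[of n]
  unfolding lessThan_Suc_atMost[symmetric] sum.lessThan_Suc_shift sum_negf by simp

lemma summable_minus_sqrt_coeff_Suc: "summable (\<lambda>k. - sqrt_coeff (Suc k))"
  using sum_minus_sqrt_coeff_Suc_le sqrt_coeff_Suc_nonpos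
  by (intro bounded_imp_summable[where B = 1])
     (auto simp: lessThan_Suc_atMost[symmetric] simp del: sum.lessThan_Suc)

lemma suminf_minus_sqrt_coeff_Suc_le: "(\<Sum>k. - sqrt_coeff (Suc k)) \<le> 1"
  using summable_minus_sqrt_coeff_Suc sum_minus_sqrt_coeff_Suc_le by (intro suminf_le_const)

lemma summable_abs_sqrt_coeff: "summable (\<lambda>k. \<bar>sqrt_coeff k\<bar>)"
proof -
  have "summable (\<lambda>k. \<bar>sqrt_coeff (Suc k)\<bar>)"
    using summable_minus_sqrt_coeff_Suc sqrt_coeff_Suc_nonpos
    by (simp add: abs_of_nonpos)
  then show ?thesis
    by (rule summable_Suc_iff[THEN iffD1])
qed

text \<open>Stated for bounded sequences rather than powers of one element, so that the series can be
  summed entry by entry for a matrix whose powers have bounded entries.\<close>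

lemma summable_norm_sqrt_series:
  fixes u :: "nat \<Rightarrow> 'a::real_normed_vector"
  assumes "\<And>k. norm (u k) \<le> B"
  shows "summable (\<lambda>k. norm (sqrt_coeff k *\<^sub>R u k))"
proof (rule summable_comparison_test')
  show "summable (\<lambda>k. \<bar>sqrt_coeff k\<bar> * B)"
    using summable_abs_sqrt_coeff by (rule summable_mult2)
  show "norm (norm (sqrt_coeff k *\<^sub>R u k)) \<le> \<bar>sqrt_coeff k\<bar> * B" for k
    using assms[of k] by (simp add: mult_left_mono)
qed

lemma summable_sqrt_series:
  fixes u :: "nat \<Rightarrow> 'a::banach"
  assumes "\<And>k. norm (u k) \<le> B"
  shows "summable (\<lambda>k. sqrt_coeff k *\<^sub>R u k)"
  using summable_norm_sqrt_series[OF assms] by (rule summable_norm_cancel)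

lemma sqrt_series_mult_sums:
  fixes u v :: "nat \<Rightarrow> 'a::{real_normed_algebra, banach}"
  assumes "\<And>k. norm (u k) \<le> B" and "\<And>k. norm (v k) \<le> C"
  shows "(\<lambda>k. \<Sum>i\<le>k. (sqrt_coeff i * sqrt_coeff (k - i)) *\<^sub>R (u i * v (k - i))) sums
    ((\<Sum>k. sqrt_coeff k *\<^sub>R u k) * (\<Sum>k. sqrt_coeff k *\<^sub>R v k))"
  using Cauchy_product_sums[OF summable_norm_sqrt_series[of u, OF assms(1)]
      summable_norm_sqrt_series[of v, OF assms(2)]]
  by (simp add: mult.commute)

lemma sqrt_convolution_sums:
  fixes w :: "nat \<Rightarrow> 'a::real_normed_vector"
  shows "(\<lambda>k. (\<Sum>i\<le>k. sqrt_coeff i * sqrt_coeff (k - i)) *\<^sub>R w k) sums (w 0 - w 1)"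
  using sums_finite[of "{0, 1}" "\<lambda>k. (\<Sum>i\<le>k. sqrt_coeff i * sqrt_coeff (k - i)) *\<^sub>R w k"]
  by (simp add: sqrt_coeff_convolution)

definition sqrt_series :: "'a::{real_normed_algebra_1, banach} \<Rightarrow> 'a" where
  "sqrt_series h = (\<Sum>k. sqrt_coeff k *\<^sub>R h ^ k)"

lemma norm_power_le_one: "norm (h ^ k) \<le> 1"
  if "norm h \<le> 1" for h :: "'a::real_normed_algebra_1"
  using norm_power_ineq[of h k] power_le_one[of "norm h" k] that by simp

lemma sqrt_series_square:
  fixes h :: "'a::{real_normed_algebra_1, banach}"
  assumes "norm h \<le> 1"
  shows "sqrt_series h * sqrt_series h = 1 - h"
proof -
  have "(\<lambda>k. \<Sum>i\<le>k. (sqrt_coeff i * sqrt_coeff (k - i)) *\<^sub>R (h ^ i * h ^ (k - i))) sums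
      (sqrt_series h * sqrt_series h)"
    unfolding sqrt_series_def
    by (rule sqrt_series_mult_sums[OF norm_power_le_one[OF assms] norm_power_le_one[OF assms]])
  also have "(\<lambda>k. \<Sum>i\<le>k. (sqrt_coeff i * sqrt_coeff (k - i)) *\<^sub>R (h ^ i * h ^ (k - i)))
      = (\<lambda>k. (\<Sum>i\<le>k. sqrt_coeff i * sqrt_coeff (k - i)) *\<^sub>R h ^ k)"
    by (simp add: power_add[symmetric] scaleR_sum_left)
  finally show ?thesis
    using sqrt_convolution_sums[of "\<lambda>k. h ^ k"] by (simp add: sums_unique2)
qed

text \<open>The series for \<open>1 - sqrt (1 - h)\<close> has nonnegative coefficients of total mass at most \<open>1\<close>.
  For selfadjoint \<open>h\<close> the bound says that the square root so obtained is itself positive.\<close>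

lemma norm_one_minus_sqrt_series_le:
  fixes h :: "'a::{real_normed_algebra_1, banach}"
  assumes "norm h \<le> 1"
  shows "norm (1 - sqrt_series h) \<le> 1"
proof -
  have s: "summable (\<lambda>k. sqrt_coeff k *\<^sub>R h ^ k)"
    using norm_power_le_one[OF assms] by (rule summable_sqrt_series)
  have "1 - sqrt_series h = - (\<Sum>k. sqrt_coeff (Suc k) *\<^sub>R h ^ Suc k)"
    unfolding sqrt_series_def using suminf_split_head[OF s] by simp
  also have "norm \<dots> \<le> (\<Sum>k. - sqrt_coeff (Suc k))"
    unfolding norm_minus_cancel
  proof (rule order_trans[OF summable_norm suminf_le])
    show "summable (\<lambda>k. norm (sqrt_coeff (Suc k) *\<^sub>R h ^ Suc k))"
      using summable_norm_sqrt_series[of "\<lambda>k. h ^ k", OF norm_power_le_one[OF assms]]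
      by (rule summable_ignore_initial_segment[where k = 1, simplified])
    then show "summable (\<lambda>k. norm (sqrt_coeff (Suc k) *\<^sub>R h ^ Suc k))" .
    show "norm (sqrt_coeff (Suc k) *\<^sub>R h ^ Suc k) \<le> - sqrt_coeff (Suc k)" for k
      using sqrt_coeff_Suc_nonpos[of k] norm_power_le_one[OF assms, of "Suc k"]
        mult_left_mono[of "norm (h ^ Suc k)" 1 "- sqrt_coeff (Suc k)"]
      by (simp add: abs_of_nonpos del: power_Suc)
  qed (rule summable_minus_sqrt_coeff_Suc)
  also have "\<dots> \<le> 1"
    by (rule suminf_minus_sqrt_coeff_Suc_le)
  finally show ?thesis .
qed

lemma sqrt_series_commute:
  fixes h :: "'a::{real_normed_algebra_1, banach}"
  assumes "norm h \<le> 1" and "x * h = h * x"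
  shows "x * sqrt_series h = sqrt_series h * x"
proof -
  have s: "summable (\<lambda>k. sqrt_coeff k *\<^sub>R h ^ k)"
    using norm_power_le_one[OF assms(1)] by (rule summable_sqrt_series)
  have "x * h ^ k = h ^ k * x" for k
    using assms(2) by (simp add: power_commuting_commutes[symmetric])
  then show ?thesis
    unfolding sqrt_series_def by (simp add: suminf_mult[OF s, symmetric] suminf_mult2[OF s])
qed

section \<open>Elementary rules for scalars and the involution\<close>

lemma scaleC_zero [simp]: "c *\<^sub>C 0 = (0 :: 'a::unital_cstar_algebra)"
  using scaleC_add_right[of c "0 :: 'a" 0] by simp

lemma scaleC_minus_right: "c *\<^sub>C (- x) = - (c *\<^sub>C x)" for x :: "'a::unital_cstar_algebra"
proof -
  have "c *\<^sub>C x + c *\<^sub>C (- x) = 0"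
    by (simp flip: scaleC_add_right)
  then show ?thesis
    by (simp add: minus_unique)
qed

lemma scaleC_minus_left: "(- c) *\<^sub>C x = - (c *\<^sub>C x)" for x :: "'a::unital_cstar_algebra"
  using scaleC_add_left[of c "- c" x] scaleC_add_left[of 0 0 x]
  by (simp add: minus_unique)

lemma scaleC_diff_right: "c *\<^sub>C (x - y) = c *\<^sub>C x - c *\<^sub>C y" for x :: "'a::unital_cstar_algebra"
  using scaleC_add_right[of c x "- y"] by (simp add: scaleC_minus_right)

lemma scaleC_one [simp]: "1 *\<^sub>C x = x" for x :: "'a::unital_cstar_algebra"
  using scaleR_scaleC[of 1 x] by simp

lemma scaleC_i_i: "\<i> *\<^sub>C \<i> *\<^sub>C x = - x" for x :: "'a::unital_cstar_algebra"
  by (simp add: scaleC_scaleC scaleC_minus_left)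

lemmas scaleC_simps = scaleC_add_right scaleC_diff_right scaleC_minus_right scaleC_minus_left
  mult_scaleC_left mult_scaleC_right scaleC_i_i

lemma star_scaleR: "star (r *\<^sub>R x) = r *\<^sub>R star x" for x :: "'a::unital_cstar_algebra"
  by (simp add: scaleR_scaleC star_scaleC)

lemma star_zero [simp]: "star (0 :: 'a::unital_cstar_algebra) = 0"
  using star_scaleR[of 0 0] by simp

lemma star_uminus: "star (- x) = - star x" for x :: "'a::unital_cstar_algebra"
  using star_scaleR[of "-1" x] by simp

lemma star_diff: "star (x - y) = star x - star y" for x :: "'a::unital_cstar_algebra"
  using star_add[of x "- y"] by (simp add: star_uminus)

lemma star_one [simp]: "star (1 :: 'a::unital_cstar_algebra) = 1"
  using star_mult[of "star 1" "1 :: 'a"] by (simp add: star_star)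

lemma star_sum: "star (\<Sum>i\<in>I. f i) = (\<Sum>i\<in>I. star (f i))" for f :: "_ \<Rightarrow> 'a::unital_cstar_algebra"
  by (induction I rule: infinite_finite_induct) (auto simp: star_add)

lemma star_power: "star (x ^ k) = star x ^ k" for x :: "'a::unital_cstar_algebra"
  by (induction k) (auto simp: star_mult power_commutes)

lemma norm_star: "norm (star x) = norm x" for x :: "'a::unital_cstar_algebra"
proof -
  have "norm y \<le> norm (star y)" for y :: 'a
    using cstar_identity[of y] norm_mult_ineq[of "star y" y]
    by (cases "norm y = 0") (auto simp: power2_eq_square)
  from this[of x] this[of "star x"] show ?thesis
    by (simp add: star_star)
qed

lemma bounded_linear_star: "bounded_linear (star :: 'a::unital_cstar_algebra \<Rightarrow> 'a)"
  by (rule bounded_linear_intro[where K = 1]) (auto simp: star_add star_scaleR norm_star)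

lemma star_suminf:
  fixes f :: "nat \<Rightarrow> 'a::unital_cstar_algebra"
  shows "summable f \<Longrightarrow> star (\<Sum>k. f k) = (\<Sum>k. star (f k))"
  by (rule bounded_linear.suminf[OF bounded_linear_star])

lemmas star_simps = star_star star_add star_diff star_uminus star_mult star_scaleR

lemma selfadjoint_sqrt_series:
  fixes h :: "'a::unital_cstar_algebra"
  assumes "norm h \<le> 1" and "selfadjoint h"
  shows "selfadjoint (sqrt_series h)"
  unfolding sqrt_series_def selfadjoint_def
  using assms(2)
  by (subst star_suminf[OF summable_sqrt_series, OF norm_power_le_one[OF assms(1)]])
     (simp add: selfadjoint_def star_scaleR star_power)

lemma norm_square_selfadjoint: "norm (a * a) = (norm a)\<^sup>2"
  if "selfadjoint a" for a :: "'a::unital_cstar_algebra"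
  using cstar_identity[of a] that by (simp add: selfadjoint_def)

section \<open>Positive elements of a C*-algebra\<close>

text \<open>In function-algebra terms: a bounded real function \<open>a\<close> is nonnegative iff \<open>r - a\<close> is bounded by \<open>r\<close> in
  absolute value for some \<open>r\<close>. With this metric description, closure under sums is just the
  triangle inequality, and \<open>1 - a / r\<close> is an argument at which the square root series converges.
  That it describes the elements \<open>x\<^sup>* x\<close> is the content of this section.\<close>

definition positive_element :: "'a::unital_cstar_algebra \<Rightarrow> bool" where
  "positive_element a \<longleftrightarrow> selfadjoint a \<and> (\<exists>r. norm (r *\<^sub>R 1 - a) \<le> r)"

lemma positive_elementI: "selfadjoint a \<Longrightarrow> norm (r *\<^sub>R 1 - a) \<le> r \<Longrightarrow> positive_element a"
  unfolding positive_element_def by blast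

lemma positive_element_selfadjoint: "positive_element a \<Longrightarrow> star a = a"
  by (simp add: positive_element_def selfadjoint_def)

lemma positive_element_zero [simp]: "positive_element 0"
  by (rule positive_elementI[where r = 0]) (auto simp: selfadjoint_def)

lemma positive_element_add:
  assumes "positive_element a" "positive_element b"
  shows "positive_element (a + b)"
proof -
  obtain r s where "norm (r *\<^sub>R 1 - a) \<le> r" "norm (s *\<^sub>R 1 - b) \<le> s"
    using assms unfolding positive_element_def by blast
  then have "norm ((r *\<^sub>R 1 - a) + (s *\<^sub>R 1 - b)) \<le> r + s"
    using norm_triangle_ineq[of "r *\<^sub>R 1 - a" "s *\<^sub>R 1 - b"] by linarith
  moreover have "(r + s) *\<^sub>R 1 - (a + b) = (r *\<^sub>R 1 - a) + (s *\<^sub>R 1 - b)"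
    by (simp add: algebra_simps)
  ultimately have "norm ((r + s) *\<^sub>R 1 - (a + b)) \<le> r + s"
    by (simp only:)
  then show ?thesis
    using assms by (intro positive_elementI) (auto simp: positive_element_def selfadjoint_def star_add)
qed

lemma positive_element_scaleR:
  assumes "positive_element a" "t \<ge> 0"
  shows "positive_element (t *\<^sub>R a)"
proof -
  obtain r where "norm (r *\<^sub>R 1 - a) \<le> r"
    using assms unfolding positive_element_def by blast
  moreover have "(t * r) *\<^sub>R 1 - t *\<^sub>R a = t *\<^sub>R (r *\<^sub>R 1 - a)"
    by (simp add: algebra_simps)
  ultimately have "norm ((t * r) *\<^sub>R 1 - t *\<^sub>R a) \<le> t * r"
    using assms(2) by (simp add: mult_left_mono)
  then show ?thesis
    using assms by (intro positive_elementI) (auto simp: positive_element_def selfadjoint_def star_scaleR)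
qed

lemma positive_element_sum:
  "(\<And>i. i \<in> I \<Longrightarrow> positive_element (f i)) \<Longrightarrow> positive_element (\<Sum>i\<in>I. f i)"
  by (induction I rule: infinite_finite_induct) (auto intro: positive_element_add)

lemma positive_scalar_minus:
  assumes "selfadjoint a" "norm a \<le> r"
  shows "positive_element (r *\<^sub>R 1 - a)"
  using assms by (intro positive_elementI[where r = r]) (auto simp: selfadjoint_def star_simps)

lemma positive_element_sqrt:
  assumes "positive_element a"
  obtains s where "positive_element s" "s * s = a" "\<And>x. x * a = a * x \<Longrightarrow> x * s = s * x"
proof -
  obtain r where r: "norm (r *\<^sub>R 1 - a) \<le> r" and sa: "selfadjoint a"
    using assms unfolding positive_element_def by blast
  have "r \<ge> 0"
    using r norm_ge_zero order_trans by blast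
  show ?thesis
  proof (cases "r = 0")
    case True
    then show ?thesis
      using r that[of 0] by simp
  next
    case False
    with \<open>r \<ge> 0\<close> have "r > 0" by simp
    define h where "h = 1 - (1 / r) *\<^sub>R a"
    have "h = (1 / r) *\<^sub>R (r *\<^sub>R 1 - a)"
      using \<open>r > 0\<close> by (simp add: h_def algebra_simps)
    then have "norm h = (1 / r) * norm (r *\<^sub>R 1 - a)"
      using \<open>r > 0\<close> by (simp only: norm_scaleR) simp
    then have h: "norm h \<le> 1"
      using r \<open>r > 0\<close> by (simp only:) (simp add: field_simps)
    have "selfadjoint h"
      using sa by (simp add: h_def selfadjoint_def star_simps)
    then have "positive_element (sqrt_series h)"
      using selfadjoint_sqrt_series[OF h] norm_one_minus_sqrt_series_le[OF h]
      by (intro positive_elementI[where r = 1]) auto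
    then have "positive_element (sqrt r *\<^sub>R sqrt_series h)"
      using \<open>r > 0\<close> by (intro positive_element_scaleR) auto
    moreover have "(sqrt r *\<^sub>R sqrt_series h) * (sqrt r *\<^sub>R sqrt_series h) = a"
      using \<open>r > 0\<close> by (simp add: sqrt_series_square[OF h]) (simp add: h_def)
    moreover have "x * (sqrt r *\<^sub>R sqrt_series h) = (sqrt r *\<^sub>R sqrt_series h) * x" if "x * a = a * x" for x
      using that sqrt_series_commute[OF h, of x] by (simp add: h_def algebra_simps)
    ultimately show ?thesis
      by (rule that)
  qed
qed

text \<open>With \<open>r = norm (s\<^sup>2)\<close>, the square root \<open>c\<close> of \<open>r - s\<^sup>2\<close> commutes with \<open>s\<close>, so
  \<open>u = c + i s\<close> satisfies \<open>u\<^sup>* u = r\<close>. The real part of \<open>u\<^sup>2\<close> is \<open>c\<^sup>2 - s\<^sup>2 = r - 2 s\<^sup>2\<close>, and taking the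
  real part does not increase the norm.\<close>

lemma norm_scalar_minus_double_square_le:
  fixes s :: "'a::unital_cstar_algebra"
  assumes s: "selfadjoint s"
  shows "norm (norm (s * s) *\<^sub>R 1 - 2 *\<^sub>R (s * s)) \<le> norm (s * s)"
proof -
  define r where "r = norm (s * s)"
  obtain c where c: "positive_element c" "c * c = r *\<^sub>R 1 - s * s"
    and comm: "\<And>x. x * (r *\<^sub>R 1 - s * s) = (r *\<^sub>R 1 - s * s) * x \<Longrightarrow> x * c = c * x"
  proof (rule positive_element_sqrt)
    show "positive_element (r *\<^sub>R 1 - s * s)"
      using s by (intro positive_scalar_minus) (auto simp: r_def selfadjoint_def star_mult)
  qed blast
  have sc: "s * c = c * s"
    by (rule comm) (simp add: algebra_simps)
  have star: "star s = s" "star c = c"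
    using s positive_element_selfadjoint[OF c(1)] by (auto simp: selfadjoint_def)
  define u where "u = c + \<i> *\<^sub>C s"
  have su: "star u = c - \<i> *\<^sub>C s"
    by (simp add: u_def star_add star_scaleC star scaleC_minus_left)
  have "star u * u = (c - \<i> *\<^sub>C s) * (c + \<i> *\<^sub>C s)"
    unfolding su by (simp add: u_def)
  also have "\<dots> = c * c + s * s"
    by (simp add: algebra_simps scaleC_simps sc)
  also have "\<dots> = r *\<^sub>R 1"
    by (simp add: c)
  finally have "(norm u)\<^sup>2 = r"
    using cstar_identity[of u] by (simp add: r_def)
  then have nu: "norm (u * u) \<le> r" "norm (star u * star u) \<le> r"
    using norm_mult_ineq[of u u] norm_mult_ineq[of "star u" "star u"]
    by (auto simp: power2_eq_square norm_star)
  have "u * u + star u * star u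
      = (c + \<i> *\<^sub>C s) * (c + \<i> *\<^sub>C s) + (c - \<i> *\<^sub>C s) * (c - \<i> *\<^sub>C s)"
    unfolding su by (simp add: u_def)
  also have "\<dots> = 2 *\<^sub>R (c * c - s * s)"
    by (simp add: algebra_simps scaleC_simps sc scaleR_2)
  also have "\<dots> = 2 *\<^sub>R (r *\<^sub>R 1 - 2 *\<^sub>R (s * s))"
    by (simp add: c scaleR_2 algebra_simps)
  finally have "2 * norm (r *\<^sub>R 1 - 2 *\<^sub>R (s * s)) \<le> 2 * r"
    using norm_triangle_ineq[of "u * u" "star u * star u"] nu by simp
  then show ?thesis
    by (simp add: r_def)
qed

lemma positive_element_square:
  assumes "selfadjoint s"
  shows "positive_element (s * s)"
proof (rule positive_elementI[where r = "norm (s * s) / 2"])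
  have "(norm (s * s) / 2) *\<^sub>R 1 - s * s = (1/2) *\<^sub>R (norm (s * s) *\<^sub>R 1 - 2 *\<^sub>R (s * s))"
    by (simp add: algebra_simps)
  then show "norm ((norm (s * s) / 2) *\<^sub>R 1 - s * s) \<le> norm (s * s) / 2"
    using norm_scalar_minus_double_square_le[OF assms] by simp
qed (use assms in \<open>simp add: selfadjoint_def star_mult\<close>)

lemma norm_scalar_minus_double_positive_le:
  assumes "positive_element a"
  shows "norm (norm a *\<^sub>R 1 - 2 *\<^sub>R a) \<le> norm a"
proof -
  obtain s where "positive_element s" "s * s = a"
    using positive_element_sqrt[OF assms] by blast
  then show ?thesis
    using norm_scalar_minus_double_square_le[of s] by (simp add: positive_element_def)
qed

text \<open>Both \<open>norm a - 2 a\<close> and \<open>norm d - 2 d\<close> are bounded by \<open>norm a\<close> and \<open>norm d\<close>, respectively. Their difference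
  bounds \<open>4 a\<close> in terms of \<open>a + d\<close> and the two norms, and symmetrically for \<open>4 d\<close>; applied to the
  element of larger norm, this gives the claim without functional calculus.\<close>

lemma norm_le_norm_add_positive:
  assumes "positive_element a" "positive_element d"
  shows "norm a \<le> norm (a + d)"
proof -
  have *: "4 * norm p \<le> \<bar>norm p - norm q\<bar> + norm p + norm q + 2 * norm (p + q)"
    if "positive_element p" "positive_element q" for p q :: 'a
  proof -
    let ?P = "norm p *\<^sub>R 1 - 2 *\<^sub>R p" and ?Q = "norm q *\<^sub>R 1 - 2 *\<^sub>R q"
    have "4 *\<^sub>R p = (norm p - norm q) *\<^sub>R 1 - (?P - ?Q) + 2 *\<^sub>R (p + q)"
      by (simp add: algebra_simps flip: scaleR_add_left)
    then have "norm (4 *\<^sub>R p) \<le> norm ((norm p - norm q) *\<^sub>R 1 - (?P - ?Q)) + norm (2 *\<^sub>R (p + q))"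
      by (simp only: norm_triangle_ineq)
    moreover have "norm ((norm p - norm q) *\<^sub>R 1 - (?P - ?Q)) \<le> \<bar>norm p - norm q\<bar> + norm (?P - ?Q)"
      using norm_triangle_ineq4[of "(norm p - norm q) *\<^sub>R (1 :: 'a)" "?P - ?Q"] by simp
    moreover have "norm (?P - ?Q) \<le> norm p + norm q"
      using norm_triangle_ineq4[of ?P ?Q] norm_scalar_minus_double_positive_le[OF that(1)]
        norm_scalar_minus_double_positive_le[OF that(2)] by linarith
    ultimately show ?thesis
      by simp
  qed
  show ?thesis
    using *[OF assms] *[OF assms(2,1)] by (auto simp: add.commute abs_if split: if_splits)
qed

lemma positive_element_antisym:
  assumes "positive_element a" "positive_element (- a)"
  shows "a = 0"
  using norm_le_norm_add_positive[OF assms] by simp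

lemma positive_element_commuting_mult:
  assumes "positive_element p" "positive_element q" "p * q = q * p"
  shows "positive_element (p * q)"
proof -
  obtain s where s: "positive_element s" "s * s = p" and sc: "\<And>x. x * p = p * x \<Longrightarrow> x * s = s * x"
    using positive_element_sqrt[OF assms(1)] by metis
  obtain t where t: "positive_element t" "t * t = q" and tc: "\<And>x. x * q = q * x \<Longrightarrow> x * t = t * x"
    using positive_element_sqrt[OF assms(2)] by metis
  have "s * t = t * s"
    using assms(3) by (intro tc) (simp add: sc)
  moreover from this have "p * q = (s * t) * (s * t)"
    unfolding s(2)[symmetric] t(2)[symmetric] by (metis mult.assoc)
  ultimately show ?thesis
    using positive_element_square[of "s * t"] positive_element_selfadjoint[OF s(1)]
      positive_element_selfadjoint[OF t(1)]
    by (simp add: selfadjoint_def star_mult)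
qed

text \<open>An exponential \<open>G ^ N\<close> with \<open>G > 1\<close> outgrows every linear function of \<open>N\<close>. Exponents \<open>2 ^ m\<close>
  suffice, and for them the norm of a power of a selfadjoint element is the power of the norm.\<close>

lemma le_one_of_power_bound:
  fixes G c :: real
  assumes "\<And>m. G ^ (2 ^ m) \<le> 1 + 2 ^ m * c" and "G \<ge> 0"
  shows "G \<le> 1"
proof (rule ccontr)
  assume "\<not> G \<le> 1"
  define x where "x = 1 / G"
  have x: "norm x < 1" "x > 0"
    using \<open>\<not> G \<le> 1\<close> by (auto simp: x_def)
  have "(\<lambda>n. x ^ n + c * (of_nat n * x ^ n)) \<longlonglongrightarrow> 0 + c * 0"
    using x by (intro tendsto_intros powser_times_n_limit_0 LIMSEQ_power_zero)
  then have "eventually (\<lambda>n. x ^ n + c * (of_nat n * x ^ n) < 1) sequentially"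
    by (intro order_tendstoD) auto
  then obtain N where N: "\<And>n. n \<ge> N \<Longrightarrow> x ^ n + c * (of_nat n * x ^ n) < 1"
    unfolding eventually_sequentially by blast
  have "N \<le> 2 ^ N"
    by (rule less_imp_le[OF less_exp])
  from N[OF this] have "(1 + 2 ^ N * c) * x ^ (2 ^ N) < 1"
    by (simp add: algebra_simps)
  moreover have "G ^ (2 ^ N) * x ^ (2 ^ N) = 1"
    using \<open>\<not> G \<le> 1\<close> by (simp add: x_def power_mult_distrib[symmetric])
  ultimately show False
    using mult_right_mono[OF assms(1)[of N], of "x ^ (2 ^ N)"] x by simp
qed

lemma norm_power_two_power_selfadjoint:
  fixes a :: "'a::unital_cstar_algebra"
  assumes "selfadjoint a"
  shows "norm (a ^ (2 ^ m)) = norm a ^ (2 ^ m)"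
proof (induction m)
  case (Suc m)
  have "selfadjoint (a ^ (2 ^ m))"
    using assms by (simp add: selfadjoint_def star_power)
  from norm_square_selfadjoint[OF this] Suc show ?case
    by (simp add: power_add[symmetric] power_mult[symmetric] mult_2 mult.commute)
qed simp

text \<open>The usual argument is that \<open>y\<^sup>* y\<close> and \<open>y y\<^sup>*\<close> have the same nonzero spectrum. The spectrum can
  be avoided: with \<open>z = 1 - y\<^sup>* y / r\<close> and \<open>w = 1 - y y\<^sup>* / r\<close> one has
  \<open>z\<^sup>k = 1 - y\<^sup>* (\<Sum>j<k. w\<^sup>j) y / r\<close>, so if \<open>w\<close> is a contraction the powers of \<open>z\<close> grow at
  most linearly, which forces the selfadjoint \<open>z\<close> to be a contraction too.\<close>

lemma positive_element_swap:
  fixes y :: "'a::unital_cstar_algebra"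
  assumes "positive_element (y * star y)"
  shows "positive_element (star y * y)"
proof -
  obtain r where r: "norm (r *\<^sub>R 1 - y * star y) \<le> r"
    using assms unfolding positive_element_def by blast
  then have "r \<ge> 0"
    using norm_ge_zero order_trans by blast
  show ?thesis
  proof (cases "r = 0")
    case True
    then have "y = 0"
      using r cstar_identity[of "star y"] by (simp add: star_star norm_star)
    then show ?thesis
      by simp
  next
    case False
    with \<open>r \<ge> 0\<close> have "r > 0" by simp
    define w z where "w = 1 - (1 / r) *\<^sub>R (y * star y)" and "z = 1 - (1 / r) *\<^sub>R (star y * y)"
    have "w = (1 / r) *\<^sub>R (r *\<^sub>R 1 - y * star y)"
      using \<open>r > 0\<close> by (simp add: w_def algebra_simps)
    then have "norm w = (1 / r) * norm (r *\<^sub>R 1 - y * star y)"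
      using \<open>r > 0\<close> by (simp only: norm_scaleR) simp
    then have w: "norm w \<le> 1"
      using r \<open>r > 0\<close> by (simp only:) (simp add: field_simps)
    define c where "c = (norm y)\<^sup>2 / r"
    have zw: "z ^ k * star y = star y * w ^ k" for k
    proof (induction k)
      case (Suc k)
      have "z * star y = star y * w"
        by (simp add: z_def w_def algebra_simps)
      then show ?case
        using Suc by (metis mult.assoc power_Suc)
    qed simp
    have bound: "norm (z ^ k) \<le> 1 + k * c" for k
    proof (induction k)
      case (Suc k)
      have "z ^ Suc k = z ^ k - (1 / r) *\<^sub>R (z ^ k * star y * y)"
        by (simp add: power_Suc2 z_def algebra_simps del: power_Suc)
      also have "\<dots> = z ^ k - (1 / r) *\<^sub>R (star y * w ^ k * y)"
        by (simp add: zw)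
      also have "norm \<dots> \<le> norm (z ^ k) + norm (star y * w ^ k * y) / r"
        using norm_triangle_ineq4[of "z ^ k" "(1 / r) *\<^sub>R (star y * w ^ k * y)"] \<open>r > 0\<close> by simp
      also have "norm (star y * w ^ k * y) \<le> norm y * 1 * norm y"
        using norm_power_le_one[OF w, of k]
        by (intro order_trans[OF norm_mult_ineq] mult_mono order_trans[OF norm_mult_ineq[of "star y"]])
           (auto simp: norm_star)
      finally show ?case
        using Suc \<open>r > 0\<close>
        by (simp add: c_def power2_eq_square algebra_simps add_divide_distrib divide_right_mono)
    qed simp
    have "selfadjoint z"
      by (simp add: selfadjoint_def z_def star_simps)
    have "norm z \<le> 1"
    proof (rule le_one_of_power_bound)
      show "norm z ^ 2 ^ m \<le> 1 + 2 ^ m * c" for m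
        using bound[of "2 ^ m"] norm_power_two_power_selfadjoint[OF \<open>selfadjoint z\<close>, of m] by simp
    qed simp
    moreover have "r *\<^sub>R 1 - star y * y = r *\<^sub>R z"
      using \<open>r > 0\<close> by (simp add: z_def algebra_simps)
    ultimately show ?thesis
      using \<open>r > 0\<close> by (intro positive_elementI[where r = r]) (auto simp: selfadjoint_def star_simps mult_left_le)
  qed
qed

lemma selfadjoint_nilpotent:
  fixes d :: "'a::unital_cstar_algebra"
  assumes "selfadjoint d" and "d * (d * d) = 0"
  shows "d = 0"
proof -
  have "norm (d ^ (2 ^ 2)) = 0"
    using assms(2) by (simp add: numeral_eq_Suc)
  then show ?thesis
    unfolding norm_power_two_power_selfadjoint[OF assms(1)] by simp
qed

text \<open>Four times the sum of squares of the real and imaginary parts of \<open>y\<close> is twice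
  \<open>y\<^sup>* y + y y\<^sup>*\<close>.\<close>

lemma star_mult_self_add_swap_positive:
  fixes y :: "'a::unital_cstar_algebra"
  shows "positive_element (star y * y + y * star y)"
proof -
  define u v where "u = y + star y" and "v = \<i> *\<^sub>C (y - star y)"
  have "selfadjoint u"
    by (simp add: selfadjoint_def u_def star_simps add.commute)
  moreover have "selfadjoint v"
    by (simp add: selfadjoint_def v_def star_scaleC star_simps scaleC_simps)
  ultimately have "positive_element ((1/2) *\<^sub>R (u * u + v * v))"
    by (intro positive_element_scaleR positive_element_add positive_element_square) auto
  moreover have "v * v = - ((y - star y) * (y - star y))"
    by (simp only: v_def mult_scaleC_left mult_scaleC_right scaleC_i_i)
  then have "u * u + v * v = 2 *\<^sub>R (star y * y + y * star y)"
    by (simp add: u_def algebra_simps scaleR_2)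
  ultimately show ?thesis
    by simp
qed

text \<open>Let \<open>a = x\<^sup>* x\<close>, let \<open>b\<close> be the positive square root of \<open>a\<^sup>2\<close>, and \<open>d = b - a\<close> (twice the
  negative part of \<open>a\<close>). Since \<open>a d = - b d\<close>, the element \<open>y = x d\<close> has \<open>y\<^sup>* y = - b d\<^sup>2\<close>, a negative
  element. Then \<open>y y\<^sup>* = (y\<^sup>* y + y y\<^sup>*) + b d\<^sup>2\<close> is positive, hence so is \<open>y\<^sup>* y\<close>, and \<open>y\<^sup>* y\<close> is both positive
  and negative. So \<open>b d\<^sup>2 = 0\<close>, therefore \<open>d\<^sup>3 = 2 b d\<^sup>2 = 0\<close>, \<open>d = 0\<close> and \<open>a = b\<close>.\<close>

theorem positive_star_mult_self:
  fixes x :: "'a::unital_cstar_algebra"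
  shows "positive_element (star x * x)"
proof -
  define a where "a = star x * x"
  have a: "star a = a"
    by (simp add: a_def star_simps)
  obtain b where b: "positive_element b" "b * b = a * a"
      and comm: "\<And>x. x * (a * a) = (a * a) * x \<Longrightarrow> x * b = b * x"
    using positive_element_sqrt[OF positive_element_square] a by (metis selfadjoint_def)
  have ab: "a * b = b * a"
    by (rule comm) (simp add: mult.assoc)
  have bstar: "star b = b"
    using b(1) by (rule positive_element_selfadjoint)
  define d where "d = b - a"
  have d: "star d = d" "d * b = b * d" "d * a = a * d"
    by (auto simp: d_def star_simps a bstar algebra_simps ab)
  have ad: "a * d = - (b * d)"
    by (simp add: d_def algebra_simps b ab)
  define y where "y = x * d"
  have yy: "star y * y = - (b * (d * d))"
  proof -
    have "star y * y = d * (a * d)"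
      by (simp add: y_def star_simps d a_def mult.assoc)
    also have "\<dots> = - (b * (d * d))"
      using d(2) by (simp add: ad flip: mult.assoc)
    finally show ?thesis .
  qed
  have "b * (d * d) = d * (b * d)"
    using d(2) by (simp flip: mult.assoc)
  also have "\<dots> = d * d * b"
    using d(2) by (simp add: mult.assoc)
  finally have pos: "positive_element (b * (d * d))"
    using b(1) d(1) by (intro positive_element_commuting_mult positive_element_square)
      (simp_all add: selfadjoint_def)
  have eq: "y * star y = (star y * y + y * star y) + b * (d * d)"
    unfolding yy by (simp add: algebra_simps)
  then have "positive_element (y * star y)"
    by (subst eq) (intro positive_element_add star_mult_self_add_swap_positive pos)
  then have "positive_element (- (b * (d * d)))"
    using positive_element_swap yy by metis
  with pos have bdd: "b * (d * d) = 0"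
    by (rule positive_element_antisym)
  have "d * d = 2 *\<^sub>R (b * d)"
    by (simp add: d_def algebra_simps b ab scaleR_2)
  then have "d * (d * d) = 2 *\<^sub>R ((d * b) * d)"
    by (simp add: mult.assoc)
  also have "\<dots> = 2 *\<^sub>R (b * (d * d))"
    by (simp add: d(2) mult.assoc)
  finally have "d = 0"
    using bdd d(1) selfadjoint_nilpotent[of d] by (simp add: selfadjoint_def)
  then show ?thesis
    using b(1) by (simp add: d_def a_def)
qed

lemma positive_element_conjugate:
  fixes p :: "'a::unital_cstar_algebra"
  assumes "positive_element p"
  shows "positive_element (star c * p * c)"
proof -
  obtain s where "positive_element s" "s * s = p"
    using positive_element_sqrt[OF assms] by blast
  then have "star c * p * c = star (s * c) * (s * c)"
    using positive_element_selfadjoint[of s] by (auto simp: star_mult mult.assoc)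
  then show ?thesis
    by (simp add: positive_star_mult_self)
qed

lemma star_mult_self_le_norm: "positive_element ((norm a)\<^sup>2 *\<^sub>R 1 - star a * a)"
  for a :: "'a::unital_cstar_algebra"
  by (intro positive_scalar_minus) (auto simp: selfadjoint_def star_simps cstar_identity)

section \<open>Contractions on Hilbert modules\<close>

text \<open>The algebra-valued inner product of the Hilbert module of columns of length \<open>n\<close>.\<close>

definition module_inner :: "nat \<Rightarrow> (nat \<Rightarrow> 'a::unital_cstar_algebra) \<Rightarrow> (nat \<Rightarrow> 'a) \<Rightarrow> 'a" where
  "module_inner n f g = (\<Sum>i<n. star (f i) * g i)"

lemma module_inner_self_positive: "positive_element (module_inner n u u)"
  unfolding module_inner_def by (intro positive_element_sum positive_star_mult_self)

text \<open>A Cauchy-Schwarz inequality with a crude constant, by induction on the length of the row: the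
  parallelogram identity gives \<open>(S + y)\<^sup>* (S + y) \<le> 2 S\<^sup>* S + 2 y\<^sup>* y\<close>, and
  \<open>a\<^sup>* a \<le> norm a\<^sup>2\<close> bounds the new term.\<close>

lemma star_row_mult_le:
  fixes a :: "nat \<Rightarrow> 'a::unital_cstar_algebra"
  shows "\<exists>C\<ge>0. \<forall>u. positive_element
    (C *\<^sub>R module_inner m u u - star (\<Sum>i<m. a i * u i) * (\<Sum>i<m. a i * u i))"
proof (induction m)
  case 0
  show ?case
    by (auto simp: module_inner_def)
next
  case (Suc m)
  then obtain C where C: "C \<ge> 0"
    and pos: "\<And>u. positive_element (C *\<^sub>R module_inner m u u - star (\<Sum>i<m. a i * u i) * (\<Sum>i<m. a i * u i))"
    by blast
  let ?N = "(norm (a m))\<^sup>2"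
  show ?case
  proof (intro exI[of _ "2 * C + 2 * ?N"] conjI allI)
    show "2 * C + 2 * ?N \<ge> 0"
      using C by simp
    fix u :: "nat \<Rightarrow> 'a"
    define I S y where "I = module_inner m u u" and "S = (\<Sum>i<m. a i * u i)" and "y = a m * u m"
    have "positive_element (2 *\<^sub>R (C *\<^sub>R I - star S * S) + (2 * ?N) *\<^sub>R I + (2 * C) *\<^sub>R (star (u m) * u m)
        + 2 *\<^sub>R (star (u m) * (?N *\<^sub>R 1 - star (a m) * a m) * u m) + star (S - y) * (S - y))"
      using C unfolding I_def S_def
      by (intro positive_element_add positive_element_scaleR positive_star_mult_self
          module_inner_self_positive pos positive_element_conjugate star_mult_self_le_norm) auto
    also have "2 *\<^sub>R (C *\<^sub>R I - star S * S) + (2 * ?N) *\<^sub>R I + (2 * C) *\<^sub>R (star (u m) * u m)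
        + 2 *\<^sub>R (star (u m) * (?N *\<^sub>R 1 - star (a m) * a m) * u m) + star (S - y) * (S - y)
      = (2 * C + 2 * ?N) *\<^sub>R (I + star (u m) * u m) - star (S + y) * (S + y)"
      by (simp add: y_def star_simps algebra_simps scaleR_2)
    finally show "positive_element ((2 * C + 2 * ?N) *\<^sub>R module_inner (Suc m) u u
        - star (\<Sum>i<Suc m. a i * u i) * (\<Sum>i<Suc m. a i * u i))"
      by (simp add: I_def S_def y_def module_inner_def)
  qed
qed

lemma matrix_mult_le:
  fixes B :: "nat \<Rightarrow> nat \<Rightarrow> 'a::unital_cstar_algebra"
  obtains C where "C \<ge> 0" "\<And>u. positive_element (C *\<^sub>R module_inner m u u
    - module_inner n (\<lambda>j. \<Sum>i<m. B j i * u i) (\<lambda>j. \<Sum>i<m. B j i * u i))"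
proof -
  obtain C where C: "\<And>j. C j \<ge> 0"
    "\<And>j u. positive_element (C j *\<^sub>R module_inner m u u - star (\<Sum>i<m. B j i * u i) * (\<Sum>i<m. B j i * u i))"
    using star_row_mult_le[of m "B _"] by metis
  show ?thesis
  proof (rule that)
    show "(\<Sum>j<n. C j) \<ge> 0"
      using C(1) by (simp add: sum_nonneg)
    fix u :: "nat \<Rightarrow> 'a"
    have "positive_element (\<Sum>j<n. C j *\<^sub>R module_inner m u u - star (\<Sum>i<m. B j i * u i) * (\<Sum>i<m. B j i * u i))"
      by (intro positive_element_sum C(2))
    then show "positive_element ((\<Sum>j<n. C j) *\<^sub>R module_inner m u u
      - module_inner n (\<lambda>j. \<Sum>i<m. B j i * u i) (\<lambda>j. \<Sum>i<m. B j i * u i))"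
      by (simp add: sum_subtractf scaleR_sum_left module_inner_def[of n])
  qed
qed

lemma module_inner_adjoint:
  fixes V :: "nat \<Rightarrow> nat \<Rightarrow> 'a::unital_cstar_algebra"
  shows "module_inner n w (\<lambda>i. \<Sum>k<m. star (V k i) * u k) = module_inner m (\<lambda>k. \<Sum>i<n. V k i * w i) u"
  unfolding module_inner_def sum_distrib_left sum_distrib_right star_sum
  by (subst sum.swap) (simp add: star_mult mult.assoc)

lemma star_module_inner: "star (module_inner n f g) = module_inner n g f"
  by (simp add: module_inner_def star_sum star_simps)

lemma module_inner_diff_scaleR:
  "module_inner n (\<lambda>i. w i - t *\<^sub>R v i) (\<lambda>i. w i - t *\<^sub>R v i)
    = module_inner n w w - t *\<^sub>R module_inner n w v - t *\<^sub>R module_inner n v w + t\<^sup>2 *\<^sub>R module_inner n v v"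
  by (simp add: module_inner_def star_simps algebra_simps sum_subtractf sum.distrib
      scaleR_sum_right power2_eq_square)

text \<open>Write \<open>u = V w\<close>. Then \<open>v = w - t V\<^sup>* u\<close> has
  \<open>\<langle>v, v\<rangle> = \<langle>w, w\<rangle> - 2 t \<langle>u, u\<rangle> + t\<^sup>2 \<langle>V\<^sup>* u, V\<^sup>* u\<rangle>\<close>, and the last term is at most
  \<open>t\<^sup>2 C \<langle>u, u\<rangle>\<close>. For \<open>t C \<le> 1\<close> it is absorbed by the middle one. So \<open>1 - t V\<^sup>* V\<close>
  is a contraction of the Hilbert module, for the order and not only for the norm.\<close>

lemma gram_contraction:
  fixes V :: "nat \<Rightarrow> nat \<Rightarrow> 'a::unital_cstar_algebra"
  obtains t where "t > 0"
    "\<And>w v. (\<And>i. i < n \<Longrightarrow> v i = w i - t *\<^sub>R (\<Sum>k<m. star (V k i) * (\<Sum>l<n. V k l * w l)))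
      \<Longrightarrow> positive_element (module_inner n w w - module_inner n v v)"
proof -
  obtain C where C: "C \<ge> 0" and pos: "\<And>u. positive_element (C *\<^sub>R module_inner m u u
      - module_inner n (\<lambda>i. \<Sum>k<m. star (V k i) * u k) (\<lambda>i. \<Sum>k<m. star (V k i) * u k))"
    using matrix_mult_le[of m n "\<lambda>i k. star (V k i)"] by blast
  define t where "t = 1 / (C + 1)"
  have t: "t > 0" "t * C \<le> 1"
    using C by (auto simp: t_def field_simps)
  show ?thesis
  proof (rule that[OF t(1)])
    fix w v :: "nat \<Rightarrow> 'a"
    define u where "u = (\<lambda>k. \<Sum>l<n. V k l * w l)"
    define x where "x = (\<lambda>i. \<Sum>k<m. star (V k i) * u k)"
    assume v: "\<And>i. i < n \<Longrightarrow> v i = w i - t *\<^sub>R (\<Sum>k<m. star (V k i) * (\<Sum>l<n. V k l * w l))"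
    have vv: "module_inner n v v = module_inner n (\<lambda>i. w i - t *\<^sub>R x i) (\<lambda>i. w i - t *\<^sub>R x i)"
      unfolding module_inner_def by (intro sum.cong) (auto simp: v x_def u_def)
    have wx: "module_inner n w x = module_inner m u u"
      unfolding x_def u_def by (rule module_inner_adjoint)
    have xw: "module_inner n x w = module_inner m u u"
      using arg_cong[OF wx, of star] by (simp add: star_module_inner)
    have "positive_element ((t * (2 - t * C)) *\<^sub>R module_inner m u u
        + t\<^sup>2 *\<^sub>R (C *\<^sub>R module_inner m u u - module_inner n x x))"
      using t pos[of u] unfolding x_def
      by (intro positive_element_add positive_element_scaleR module_inner_self_positive) auto
    also have "(t * (2 - t * C)) *\<^sub>R module_inner m u u
        + t\<^sup>2 *\<^sub>R (C *\<^sub>R module_inner m u u - module_inner n x x)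
      = module_inner n w w - module_inner n v v"
      unfolding vv module_inner_diff_scaleR wx xw
      by (simp add: algebra_simps power2_eq_square flip: scaleR_2)
    finally show "positive_element (module_inner n w w - module_inner n v v)" .
  qed
qed

section \<open>Square roots of Gram matrices\<close>

primrec kernel_power :: "nat \<Rightarrow> (nat \<Rightarrow> nat \<Rightarrow> 'a::ring_1) \<Rightarrow> nat \<Rightarrow> nat \<Rightarrow> nat \<Rightarrow> 'a" where
  "kernel_power n X 0 = (\<lambda>i j. if i = j then 1 else 0)"
| "kernel_power n X (Suc k) = (\<lambda>i j. \<Sum>l<n. X i l * kernel_power n X k l j)"

lemma if_mult_distribs:
  "(if P then 1 else 0) * x = (if P then x else 0)" "x * (if P then 1 else 0) = (if P then x else 0)"
  for x :: "'a::ring_1"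
  by auto

lemma kernel_power_add:
  "i < n \<Longrightarrow> kernel_power n X (p + q) i j = (\<Sum>l<n. kernel_power n X p i l * kernel_power n X q l j)"
proof (induction p arbitrary: i)
  case 0
  then show ?case
    by (simp add: if_mult_distribs)
next
  case (Suc p)
  then show ?case
    by (simp add: sum_distrib_left sum_distrib_right mult.assoc) (rule sum.swap)
qed

lemma kernel_power_1: "j < n \<Longrightarrow> kernel_power n X 1 i j = X i j"
  by (simp add: if_mult_distribs)

lemma star_kernel_power:
  fixes X :: "nat \<Rightarrow> nat \<Rightarrow> 'a::unital_cstar_algebra"
  assumes X: "\<And>i j. i < n \<Longrightarrow> j < n \<Longrightarrow> star (X i j) = X j i"
  shows "i < n \<Longrightarrow> j < n \<Longrightarrow> star (kernel_power n X k i j) = kernel_power n X k j i"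
proof (induction k arbitrary: i j)
  case 0
  then show ?case
    by auto
next
  case (Suc k)
  have "star (kernel_power n X (Suc k) i j) = (\<Sum>l<n. kernel_power n X k j l * X l i)"
    using Suc by (simp add: star_sum star_mult X)
  also have "\<dots> = kernel_power n X (k + 1) j i"
    using Suc.prems by (simp only: kernel_power_add kernel_power_1)
  finally show ?case
    by simp
qed

definition gram_mat :: "nat \<Rightarrow> nat \<Rightarrow> (nat \<Rightarrow> nat \<Rightarrow> 'a::unital_cstar_algebra) \<Rightarrow> 'a mat" where
  "gram_mat m n V = mat n n (\<lambda>(i, j). \<Sum>k<m. star (V k i) * V k j)"

lemma star_mat_mult_self:
  assumes "Y \<in> carrier_mat m n"
  shows "star_mat Y * Y = gram_mat m n (\<lambda>k i. Y $$ (k, i))"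
  using assms
  by (intro eq_matI) (auto simp: gram_mat_def star_mat_def scalar_prod_def atLeast0LessThan)

text \<open>The powers of \<open>X = 1 - t V\<^sup>* V\<close> map each unit vector to a vector \<open>w\<close> with \<open>\<langle>w, w\<rangle> \<le> 1\<close>, so their
  entries are bounded by \<open>1\<close>. The square root series of \<open>X\<close> therefore converges entrywise to a
  selfadjoint matrix \<open>S\<close> with \<open>S\<^sup>2 = t V\<^sup>* V\<close>, and \<open>S / sqrt t\<close> is a square matrix with
  the same Gram matrix as the rectangular \<open>V\<close>.\<close>

theorem positive_gram_mat: "positive_mat n (gram_mat m n V)"
proof -
  obtain t where t: "t > 0" and contr:
    "\<And>w v. (\<And>i. i < n \<Longrightarrow> v i = w i - t *\<^sub>R (\<Sum>k<m. star (V k i) * (\<Sum>l<n. V k l * w l)))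
      \<Longrightarrow> positive_element (module_inner n w w - module_inner n v v)"
    using gram_contraction[where n = n and m = m and V = V] by blast
  define M where "M = (\<lambda>i j. \<Sum>k<m. star (V k i) * V k j)"
  define X where "X = (\<lambda>i j. (if i = j then 1 else 0) - t *\<^sub>R M i j)"
  let ?P = "kernel_power n X"
  have X: "star (X i j) = X j i" for i j
    by (simp add: X_def M_def star_simps star_sum)
  have step: "?P (Suc k) i j = ?P k i j - t *\<^sub>R (\<Sum>p<m. star (V p i) * (\<Sum>l<n. V p l * ?P k l j))"
    if "i < n" for i j k
  proof -
    have "?P (Suc k) i j = ?P k i j - t *\<^sub>R (\<Sum>l<n. M i l * ?P k l j)"
      using that by (simp add: X_def left_diff_distrib sum_subtractf scaleR_sum_right if_mult_distribs)
    also have "(\<Sum>l<n. M i l * ?P k l j) = (\<Sum>p<m. star (V p i) * (\<Sum>l<n. V p l * ?P k l j))"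
      unfolding M_def sum_distrib_left sum_distrib_right mult.assoc by (rule sum.swap)
    finally show ?thesis .
  qed
  have column: "positive_element (1 - module_inner n (\<lambda>i. ?P k i j) (\<lambda>i. ?P k i j))" if "j < n" for j k
  proof (induction k)
    case 0
    have "module_inner n (\<lambda>i. ?P 0 i j) (\<lambda>i. ?P 0 i j) = (\<Sum>i<n. if i = j then 1 else 0)"
      unfolding module_inner_def by (intro sum.cong) auto
    then show ?case
      using that by simp
  next
    case (Suc k)
    have "positive_element (module_inner n (\<lambda>i. ?P k i j) (\<lambda>i. ?P k i j)
        - module_inner n (\<lambda>i. ?P (Suc k) i j) (\<lambda>i. ?P (Suc k) i j))"
      by (rule contr) (rule step)
    from positive_element_add[OF Suc this] show ?case
      by (simp only: diff_add_cancel add_diff_eq)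
  qed
  have bound: "norm (?P k i j) \<le> 1" if "i < n" "j < n" for i j k
  proof -
    let ?p = "\<lambda>i. star (?P k i j) * ?P k i j"
    have "module_inner n (\<lambda>i. ?P k i j) (\<lambda>i. ?P k i j) = ?p i + sum ?p ({..<n} - {i})"
      unfolding module_inner_def using that by (intro sum.remove) auto
    then have "positive_element (1 - ?p i)"
      using positive_element_add[OF column[OF that(2), of k], of "sum ?p ({..<n} - {i})"]
      by (simp add: positive_element_sum positive_star_mult_self algebra_simps)
    from norm_le_norm_add_positive[OF positive_star_mult_self[of "?P k i j"] this]
    have "norm (?p i) \<le> 1"
      by simp
    then show ?thesis
      by (simp add: cstar_identity power_le_one_iff)
  qed
  define S where "S = (\<lambda>i j. \<Sum>k. sqrt_coeff k *\<^sub>R ?P k i j)"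
  have star_S: "star (S i j) = S j i" if "i < n" "j < n" for i j
    unfolding S_def using that X
    by (subst star_suminf[OF summable_sqrt_series, OF bound]) (auto simp: star_scaleR star_kernel_power)
  have S_square: "(\<Sum>l<n. S i l * S l j) = t *\<^sub>R M i j" if ij: "i < n" "j < n" for i j
  proof -
    have "(\<lambda>k. \<Sum>l<n. \<Sum>p\<le>k. (sqrt_coeff p * sqrt_coeff (k - p)) *\<^sub>R (?P p i l * ?P (k - p) l j)) sums
        (\<Sum>l<n. S i l * S l j)"
      unfolding S_def using ij by (intro sums_sum sqrt_series_mult_sums[where B = 1 and C = 1] bound) auto
    also have "(\<lambda>k. \<Sum>l<n. \<Sum>p\<le>k. (sqrt_coeff p * sqrt_coeff (k - p)) *\<^sub>R (?P p i l * ?P (k - p) l j))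
        = (\<lambda>k. (\<Sum>p\<le>k. sqrt_coeff p * sqrt_coeff (k - p)) *\<^sub>R ?P k i j)"
    proof
      fix k
      have "(\<Sum>l<n. \<Sum>p\<le>k. (sqrt_coeff p * sqrt_coeff (k - p)) *\<^sub>R (?P p i l * ?P (k - p) l j))
          = (\<Sum>p\<le>k. (sqrt_coeff p * sqrt_coeff (k - p)) *\<^sub>R ?P (p + (k - p)) i j)"
        unfolding kernel_power_add[OF ij(1)] scaleR_sum_right by (rule sum.swap)
      also have "\<dots> = (\<Sum>p\<le>k. (sqrt_coeff p * sqrt_coeff (k - p)) *\<^sub>R ?P k i j)"
        by (intro sum.cong) auto
      finally show "(\<Sum>l<n. \<Sum>p\<le>k. (sqrt_coeff p * sqrt_coeff (k - p)) *\<^sub>R (?P p i l * ?P (k - p) l j))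
          = (\<Sum>p\<le>k. sqrt_coeff p * sqrt_coeff (k - p)) *\<^sub>R ?P k i j"
        by (simp add: scaleR_sum_left)
    qed
    finally have "(\<Sum>l<n. S i l * S l j) = ?P 0 i j - ?P 1 i j"
      using sqrt_convolution_sums[of "\<lambda>k. ?P k i j"] by (rule sums_unique2)
    also have "\<dots> = t *\<^sub>R M i j"
      unfolding kernel_power_1[OF ij(2)] by (simp add: X_def)
    finally show ?thesis .
  qed
  define Z where "Z = mat n n (\<lambda>(i, j). (1 / sqrt t) *\<^sub>R S i j)"
  have "gram_mat m n V = gram_mat n n (\<lambda>k i. Z $$ (k, i))"
  proof (rule eq_matI; unfold gram_mat_def)
    fix i j
    assume "i < dim_row (mat n n (\<lambda>(i, j). \<Sum>k<n. star (Z $$ (k, i)) * Z $$ (k, j)))"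
      and "j < dim_col (mat n n (\<lambda>(i, j). \<Sum>k<n. star (Z $$ (k, i)) * Z $$ (k, j)))"
    then have ij: "i < n" "j < n"
      by auto
    have "(\<Sum>k<n. star (Z $$ (k, i)) * Z $$ (k, j)) = (\<Sum>k<n. (1 / t) *\<^sub>R (S i k * S k j))"
      using ij t by (intro sum.cong) (auto simp: Z_def star_scaleR star_S)
    also have "\<dots> = M i j"
      using ij t by (simp add: S_square flip: scaleR_sum_right)
    finally show "mat n n (\<lambda>(i, j). \<Sum>k<m. star (V k i) * V k j) $$ (i, j)
        = mat n n (\<lambda>(i, j). \<Sum>k<n. star (Z $$ (k, i)) * Z $$ (k, j)) $$ (i, j)"
      using ij by (simp add: M_def)
  qed auto
  moreover have "Z \<in> carrier_mat n n"
    by (simp add: Z_def)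
  ultimately show ?thesis
    unfolding positive_mat_def using star_mat_mult_self by metis
qed

lemma sum_lessThan_add: "(\<Sum>k<m + n. f k) = (\<Sum>k<m. f k) + (\<Sum>k<n. f (m + k))"
  for f :: "nat \<Rightarrow> 'a::comm_monoid_add"
  by (induction n) (auto simp: add.assoc)

text \<open>Stacking \<open>Y\<close> on top of \<open>Z\<close> gives a \<open>2n\<times>n\<close> matrix whose Gram matrix is
  \<open>Y\<^sup>* Y + Z\<^sup>* Z\<close>.\<close>

lemma positive_mat_add:
  assumes "positive_mat n P" "positive_mat n Q"
  shows "positive_mat n (P + Q)"
proof -
  obtain Y Z where Y: "Y \<in> carrier_mat n n" "P = star_mat Y * Y"
    and Z: "Z \<in> carrier_mat n n" "Q = star_mat Z * Z"
    using assms unfolding positive_mat_def by blast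
  have "P + Q = gram_mat (n + n) n (\<lambda>k i. if k < n then Y $$ (k, i) else Z $$ (k - n, i))"
    unfolding Y(2) Z(2) star_mat_mult_self[OF Y(1)] star_mat_mult_self[OF Z(1)]
    by (intro eq_matI) (auto simp: gram_mat_def sum_lessThan_add)
  then show ?thesis
    by (simp add: positive_gram_mat)
qed


lemma gram_mat_carrier [simp]: "gram_mat m n V \<in> carrier_mat n n"
  by (simp add: gram_mat_def)

lemma gram_mat_index: "i < n \<Longrightarrow> j < n \<Longrightarrow> gram_mat m n V $$ (i, j) = (\<Sum>k<m. star (V k i) * V k j)"
  by (simp add: gram_mat_def)

section \<open>Dissipation of completely positive and copositive parts\<close>

lemma positive_mat_gramE:
  assumes "positive_mat n P"
  obtains V where "P = gram_mat n n V"
  using assms star_mat_mult_self unfolding positive_mat_def by metis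

lemma one_mat_eq_gram_mat: "1\<^sub>m n = gram_mat n n (\<lambda>k i. if k = i then 1 else 0)"
  by (intro eq_matI) (auto simp: gram_mat_def if_mult_distribs if_distrib[of star] cong: if_cong)

text \<open>If the first \<open>n\<close> columns of \<open>W\<close> have Gram matrix \<open>diag(c, ..., c)\<close>, then
  \<open>(W x)\<^sup>* (W y) = x\<^sup>* diag(c, ..., c) y\<close>.\<close>

lemma gram_sandwich:
  fixes x y :: "nat \<Rightarrow> 'a::unital_cstar_algebra"
  assumes "\<And>l l'. l < n \<Longrightarrow> l' < n \<Longrightarrow> (\<Sum>k<m. star (W k l) * W k l') = (if l = l' then c else 0)"
  shows "(\<Sum>k<m. star (\<Sum>l<n. W k l * x l) * (\<Sum>l<n. W k l * y l)) = (\<Sum>l<n. star (x l) * c * y l)"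
proof -
  have "(\<Sum>k<m. star (\<Sum>l<n. W k l * x l) * (\<Sum>l<n. W k l * y l))
      = (\<Sum>k<m. \<Sum>l<n. \<Sum>l'<n. star (x l) * (star (W k l) * W k l') * y l')"
    by (simp add: star_sum star_mult sum_product mult.assoc)
  also have "\<dots> = (\<Sum>l<n. \<Sum>k<m. \<Sum>l'<n. star (x l) * (star (W k l) * W k l') * y l')"
    by (rule sum.swap)
  also have "\<dots> = (\<Sum>l<n. \<Sum>l'<n. \<Sum>k<m. star (x l) * (star (W k l) * W k l') * y l')"
    by (intro sum.cong refl) (rule sum.swap)
  also have "\<dots> = (\<Sum>l<n. \<Sum>l'<n. star (x l) * (\<Sum>k<m. star (W k l) * W k l') * y l')"
    by (simp add: sum_distrib_left sum_distrib_right)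
  also have "\<dots> = (\<Sum>l<n. \<Sum>l'<n. if l = l' then star (x l) * c * y l' else 0)"
    by (intro sum.cong refl) (simp add: assms)
  also have "\<dots> = (\<Sum>l<n. star (x l) * c * y l)"
    by simp
  finally show ?thesis .
qed

text \<open>The identity matrix is its own transpose, so a completely copositive map sends it to a positive
  matrix \<open>diag(\<phi> 1, ..., \<phi> 1) = W\<^sup>* W\<close>; then \<open>X\<^sup>* diag(\<phi> 1, ..., \<phi> 1) X\<close> is the Gram matrix of
  \<open>W X\<close>.\<close>

lemma positive_coCP_sandwich:
  fixes X :: "'a::unital_cstar_algebra mat"
  assumes "\<phi> \<in> coCP"
  shows "positive_mat n (mat n n (\<lambda>(i, j). \<Sum>l<n. star (X $$ (l, i)) * \<phi> 1 * X $$ (l, j)))"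
proof -
  have zero: "\<phi> 0 = 0"
    using assms by (auto simp: coCP_def bounded_maps_def dest: linear_0[OF bounded_linear.linear])
  have "positive_mat n (1\<^sub>m n :: 'a mat)"
    by (simp add: one_mat_eq_gram_mat positive_gram_mat)
  then have "positive_mat n (map_mat \<phi> (transpose_mat (1\<^sub>m n)))"
    using assms one_carrier_mat[of n] unfolding coCP_def positive_map_def by blast
  then obtain W where W: "map_mat \<phi> (1\<^sub>m n) = gram_mat n n W"
    by (auto elim: positive_mat_gramE)
  have W': "(\<Sum>k<n. star (W k l) * W k l') = (if l = l' then \<phi> 1 else 0)" if "l < n" "l' < n" for l l'
    using arg_cong[OF W, of "\<lambda>M. M $$ (l, l')"] that by (simp add: gram_mat_index zero split: if_splits)
  have "mat n n (\<lambda>(i, j). \<Sum>l<n. star (X $$ (l, i)) * \<phi> 1 * X $$ (l, j))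
      = gram_mat n n (\<lambda>k i. \<Sum>l<n. W k l * X $$ (l, i))"
    by (intro eq_matI) (simp_all add: gram_mat_def gram_sandwich[OF W'])
  then show ?thesis
    by (simp add: positive_gram_mat)
qed

text \<open>The \<open>2n\<times>2n\<close> matrix with blocks \<open>1\<close>, \<open>X\<close>, \<open>X\<^sup>*\<close>, \<open>X\<^sup>* X\<close> is the Gram matrix of the row \<open>(1, X)\<close>. Its
  image under \<open>\<phi>\<close> is a Gram matrix of some \<open>Y = (Y\<^sub>1, Y\<^sub>2)\<close>, with two block columns. The expression
  in the lemma is this image compressed by the column \<open>(- X, 1)\<close>, that is, the Gram matrix of
  \<open>Y\<^sub>2 - Y\<^sub>1 X\<close>.\<close>

lemma positive_CP_dissipation:
  fixes X :: "'a::unital_cstar_algebra mat"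
  assumes "\<phi> \<in> CP"
  shows "positive_mat n (mat n n (\<lambda>(i, j).
      \<phi> (\<Sum>k<n. star (X $$ (k, i)) * X $$ (k, j))
      - (\<Sum>k<n. \<phi> (star (X $$ (k, i))) * X $$ (k, j))
      - (\<Sum>k<n. star (X $$ (k, i)) * \<phi> (X $$ (k, j)))
      + (\<Sum>k<n. star (X $$ (k, i)) * \<phi> 1 * X $$ (k, j))))"
proof -
  let ?s = "\<lambda>i j. \<Sum>k<n. star (X $$ (k, i)) * X $$ (k, j)"
  have zero: "\<phi> 0 = 0"
    using assms by (auto simp: CP_def bounded_maps_def dest: linear_0[OF bounded_linear.linear])
  define R where "R = (\<lambda>k q. if q < n then (if k = q then 1 else 0) else X $$ (k, q - n))"
  have "positive_mat (n + n) (map_mat \<phi> (gram_mat n (n + n) R))"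
    using assms positive_gram_mat[of "n + n" n R] by (auto simp: CP_def positive_map_def)
  then obtain Y where Y: "map_mat \<phi> (gram_mat n (n + n) R) = gram_mat (n + n) (n + n) Y"
    by (auto elim: positive_mat_gramE)
  have blocks: "(\<Sum>k<n + n. star (Y k p) * Y k q) = \<phi> (\<Sum>k<n. star (R k p) * R k q)"
    if "p < n + n" "q < n + n" for p q
    using arg_cong[OF Y, of "\<lambda>M. M $$ (p, q)"] that by (simp add: gram_mat_def)
  have R: "(\<Sum>k<n. star (R k l) * R k l') = (if l = l' then 1 else 0)"
    "(\<Sum>k<n. star (R k l) * R k (n + j)) = X $$ (l, j)"
    "(\<Sum>k<n. star (R k (n + i)) * R k l) = star (X $$ (l, i))"
    "(\<Sum>k<n. star (R k (n + i)) * R k (n + j)) = ?s i j"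
    if "l < n" "l' < n" for l l' i j
    using that by (simp_all add: R_def if_distrib[of star] if_mult_distribs cong: if_cong)
  have Y11: "(\<Sum>k<n + n. star (Y k l) * Y k l') = (if l = l' then \<phi> 1 else 0)"
    if "l < n" "l' < n" for l l'
    using that by (simp add: blocks R zero)
  define V where "V = (\<lambda>k i. Y k (n + i) - (\<Sum>l<n. Y k l * X $$ (l, i)))"
  have "mat n n (\<lambda>(i, j). \<phi> (?s i j) - (\<Sum>k<n. \<phi> (star (X $$ (k, i))) * X $$ (k, j))
      - (\<Sum>k<n. star (X $$ (k, i)) * \<phi> (X $$ (k, j)))
      + (\<Sum>k<n. star (X $$ (k, i)) * \<phi> 1 * X $$ (k, j))) = gram_mat (n + n) n V"
  proof (rule eq_matI; unfold gram_mat_def)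
    \<comment> \<open>Expanding \<open>(Y\<^sub>2 - Y\<^sub>1 X)\<^sup>* (Y\<^sub>2 - Y\<^sub>1 X)\<close> gives one term for each block.\<close>
    fix i j
    assume "i < dim_row (mat n n (\<lambda>(i, j). \<Sum>k<n + n. star (V k i) * V k j))"
      and "j < dim_col (mat n n (\<lambda>(i, j). \<Sum>k<n + n. star (V k i) * V k j))"
    then have ij: "i < n" "j < n"
      by auto
    then have "0 < n" by simp
    let ?y = "\<lambda>k i. \<Sum>l<n. Y k l * X $$ (l, i)"
    have "(\<Sum>k<n + n. star (V k i) * V k j)
        = (\<Sum>k<n + n. star (Y k (n + i)) * Y k (n + j)) - (\<Sum>k<n + n. star (Y k (n + i)) * ?y k j)
          - (\<Sum>k<n + n. star (?y k i) * Y k (n + j)) + (\<Sum>k<n + n. star (?y k i) * ?y k j)"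
      unfolding V_def star_diff left_diff_distrib right_diff_distrib sum_subtractf by simp
    also have "(\<Sum>k<n + n. star (Y k (n + i)) * Y k (n + j)) = \<phi> (?s i j)"
      using ij \<open>0 < n\<close> by (simp add: blocks R)
    also have "(\<Sum>k<n + n. star (Y k (n + i)) * ?y k j)
        = (\<Sum>l<n. (\<Sum>k<n + n. star (Y k (n + i)) * Y k l) * X $$ (l, j))"
      unfolding sum_distrib_left sum_distrib_right mult.assoc by (rule sum.swap)
    also have "\<dots> = (\<Sum>l<n. \<phi> (star (X $$ (l, i))) * X $$ (l, j))"
      using ij by (intro sum.cong) (auto simp: blocks R)
    also have "(\<Sum>k<n + n. star (?y k i) * Y k (n + j))
        = (\<Sum>l<n. star (X $$ (l, i)) * (\<Sum>k<n + n. star (Y k l) * Y k (n + j)))"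
      unfolding sum_distrib_left sum_distrib_right mult.assoc star_sum star_mult by (rule sum.swap)
    also have "\<dots> = (\<Sum>l<n. star (X $$ (l, i)) * \<phi> (X $$ (l, j)))"
      using ij by (intro sum.cong) (auto simp: blocks R)
    also have "(\<Sum>k<n + n. star (?y k i) * ?y k j) = (\<Sum>l<n. star (X $$ (l, i)) * \<phi> 1 * X $$ (l, j))"
      by (rule gram_sandwich[OF Y11])
    finally show "mat n n (\<lambda>(i, j). \<phi> (?s i j) - (\<Sum>k<n. \<phi> (star (X $$ (k, i))) * X $$ (k, j))
        - (\<Sum>k<n. star (X $$ (k, i)) * \<phi> (X $$ (k, j)))
        + (\<Sum>k<n. star (X $$ (k, i)) * \<phi> 1 * X $$ (k, j))) $$ (i, j)
      = mat n n (\<lambda>(i, j). \<Sum>k<n + n. star (V k i) * V k j) $$ (i, j)"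
      using ij by simp
  qed auto
  then show ?thesis
    by (simp add: positive_gram_mat)
qed

lemma dissipation_map_mat_index:
  fixes X :: "'a::unital_cstar_algebra mat"
  assumes "X \<in> carrier_mat n n" "i < n" "j < n"
  shows "dissipation (map_mat T) X $$ (i, j) = T (\<Sum>k<n. star (X $$ (k, i)) * X $$ (k, j))
    - (\<Sum>k<n. T (star (X $$ (k, i))) * X $$ (k, j)) - (\<Sum>k<n. star (X $$ (k, i)) * T (X $$ (k, j)))"
  using assms
  by (simp add: dissipation_def star_mat_def scalar_prod_def atLeast0LessThan)

lemma dissipation_map_mat_carrier:
  "X \<in> carrier_mat n n \<Longrightarrow> dissipation (map_mat T) X \<in> carrier_mat n n"
  by (auto simp: dissipation_def star_mat_def)

text \<open>The maps \<open>a \<mapsto> g a\<close> and \<open>a \<mapsto> a g'\<close> contribute exactly \<open>- X\<^sup>* (g + g') X\<close> to the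
  dissipation, that is, \<open>X\<^sup>* \<phi>\<^sub>1(1) X + X\<^sup>* \<phi>\<^sub>2(1) X\<close>. The first summand completes the
  dissipation of \<open>\<phi>\<^sub>1\<close> to the positive matrix of the completely positive case, the second is
  positive because \<open>\<phi>\<^sub>2\<close> is completely copositive.\<close>

theorem Dis_infty_Lindblad:
  fixes g g' :: "'a::unital_cstar_algebra"
  assumes "\<phi>\<^sub>1 \<in> CP" "\<phi>\<^sub>2 \<in> coCP" "g + g' = - (\<phi>\<^sub>1 1 + \<phi>\<^sub>2 1)"
  shows "(\<lambda>a. g * a + a * g' + \<phi>\<^sub>1 a) \<in> Dis_infty"
proof -
  let ?L = "\<lambda>a. g * a + a * g' + \<phi>\<^sub>1 a"
  have \<phi>\<^sub>1: "bounded_linear \<phi>\<^sub>1" "\<And>c x. \<phi>\<^sub>1 (c *\<^sub>C x) = c *\<^sub>C \<phi>\<^sub>1 x"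
    using assms(1) by (auto simp: CP_def bounded_maps_def)
  have "?L \<in> bounded_maps"
    unfolding bounded_maps_def using \<phi>\<^sub>1
    by (auto simp: scaleC_simps intro!: bounded_linear_add bounded_linear_mult_right bounded_linear_mult_left)
  moreover have "dissipative_map n (map_mat ?L)" for n
    unfolding dissipative_map_def
  proof
    fix X :: "'a mat"
    assume X: "X \<in> carrier_mat n n"
    let ?s = "\<lambda>i j. \<Sum>k<n. star (X $$ (k, i)) * X $$ (k, j)"
    let ?P = "mat n n (\<lambda>(i, j). \<phi>\<^sub>1 (?s i j) - (\<Sum>k<n. \<phi>\<^sub>1 (star (X $$ (k, i))) * X $$ (k, j))
      - (\<Sum>k<n. star (X $$ (k, i)) * \<phi>\<^sub>1 (X $$ (k, j)))
      + (\<Sum>k<n. star (X $$ (k, i)) * \<phi>\<^sub>1 1 * X $$ (k, j)))"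
    let ?Q = "mat n n (\<lambda>(i, j). \<Sum>k<n. star (X $$ (k, i)) * \<phi>\<^sub>2 1 * X $$ (k, j))"
    have "dissipation (map_mat ?L) X = ?P + ?Q"
    proof (rule eq_matI)
      fix i j
      assume "i < dim_row (?P + ?Q)" "j < dim_col (?P + ?Q)"
      then have ij: "i < n" "j < n"
        by auto
      have "(\<Sum>k<n. star (X $$ (k, i)) * g * X $$ (k, j)) + (\<Sum>k<n. star (X $$ (k, i)) * g' * X $$ (k, j))
          = (\<Sum>k<n. star (X $$ (k, i)) * (g + g') * X $$ (k, j))"
        by (simp add: algebra_simps sum.distrib)
      also have "\<dots> = - ((\<Sum>k<n. star (X $$ (k, i)) * \<phi>\<^sub>1 1 * X $$ (k, j))
          + (\<Sum>k<n. star (X $$ (k, i)) * \<phi>\<^sub>2 1 * X $$ (k, j)))"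
        by (simp add: assms(3) distrib_left distrib_right sum.distrib sum_negf flip: minus_add_distrib)
      finally have gg: "(\<Sum>k<n. star (X $$ (k, i)) * g * X $$ (k, j)) + (\<Sum>k<n. star (X $$ (k, i)) * g' * X $$ (k, j))
          = - ((\<Sum>k<n. star (X $$ (k, i)) * \<phi>\<^sub>1 1 * X $$ (k, j))
          + (\<Sum>k<n. star (X $$ (k, i)) * \<phi>\<^sub>2 1 * X $$ (k, j)))" .
      have left: "(\<Sum>k<n. ?L (star (X $$ (k, i))) * X $$ (k, j)) = g * ?s i j
          + (\<Sum>k<n. star (X $$ (k, i)) * g' * X $$ (k, j)) + (\<Sum>k<n. \<phi>\<^sub>1 (star (X $$ (k, i))) * X $$ (k, j))"
        by (simp add: algebra_simps sum.distrib sum_distrib_left)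
      have right: "(\<Sum>k<n. star (X $$ (k, i)) * ?L (X $$ (k, j))) = ?s i j * g'
          + (\<Sum>k<n. star (X $$ (k, i)) * g * X $$ (k, j)) + (\<Sum>k<n. star (X $$ (k, i)) * \<phi>\<^sub>1 (X $$ (k, j)))"
        by (simp add: algebra_simps sum.distrib sum_distrib_right)
      have rearrange: "(a + b + c) - (a + x' + p) - (b + x + q) = (c - p - q + y) + z"
        if "x + x' = - (y + z)" for a b c p q x x' y z :: 'a
      proof -
        have "x = - (y + z) - x'"
          using that by (simp add: eq_diff_eq)
        then show ?thesis
          by (simp add: algebra_simps)
      qed
      show "dissipation (map_mat ?L) X $$ (i, j) = (?P + ?Q) $$ (i, j)"
        unfolding dissipation_map_mat_index[OF X ij] left right rearrange[OF gg]
        using ij by simp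
    qed (use dissipation_map_mat_carrier[OF X, of ?L] in auto)
    then show "positive_mat n (dissipation (map_mat ?L) X)"
      using positive_mat_add[OF positive_CP_dissipation[OF assms(1)] positive_coCP_sandwich[OF assms(2)]]
      by simp
  qed
  ultimately show ?thesis
    by (simp add: Dis_infty_def)
qed

theorem theorem4:
  fixes \<phi> :: "'a::unital_cstar_algebra \<Rightarrow> 'a" and H :: 'a
  assumes "\<phi> \<in> decomposable" and "selfadjoint H"
  shows "\<exists>L\<^sub>1 \<in> bounded_maps. \<exists>L\<^sub>2 \<in> bounded_maps.
    L\<^sub>1 \<in> Dis_infty \<and> L\<^sub>2 \<in> coCP \<and> L\<^sub>1 1 + L\<^sub>2 1 = 0 \<and>
    (\<forall>a. L\<^sub>1 a + L\<^sub>2 a =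
      \<i> *\<^sub>C commutator H a + \<phi> a - (1/2) *\<^sub>C anticommutator (\<phi> 1) a)"
proof -
  obtain \<phi>\<^sub>1 \<phi>\<^sub>2 where \<phi>: "\<phi>\<^sub>1 \<in> CP" "\<phi>\<^sub>2 \<in> coCP" "\<And>a. \<phi> a = \<phi>\<^sub>1 a + \<phi>\<^sub>2 a"
    using assms(1) by (auto simp: decomposable_def)
  define K where "K = \<phi> 1"
  define g g' where "g = \<i> *\<^sub>C H - (1/2) *\<^sub>C K" and "g' = - (\<i> *\<^sub>C H) - (1/2) *\<^sub>C K"
  define L where "L = (\<lambda>a. g * a + a * g' + \<phi>\<^sub>1 a)"
  have half: "(1/2) *\<^sub>C K + (1/2) *\<^sub>C K = K"
    by (simp flip: scaleC_add_left)
  then have gg: "g + g' = - (\<phi>\<^sub>1 1 + \<phi>\<^sub>2 1)"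
    by (simp add: g_def g'_def K_def \<phi>(3) algebra_simps)
  have "L \<in> Dis_infty"
    unfolding L_def using \<phi>(1,2) gg by (rule Dis_infty_Lindblad)
  moreover have "L 1 + \<phi>\<^sub>2 1 = 0"
    unfolding L_def mult_1_left mult_1_right gg by simp
  moreover have "L a + \<phi>\<^sub>2 a = \<i> *\<^sub>C commutator H a + \<phi> a - (1/2) *\<^sub>C anticommutator (\<phi> 1) a" for a
    unfolding L_def g_def g'_def commutator_def anticommutator_def K_def[symmetric] \<phi>(3)[of a]
    by (simp add: algebra_simps scaleC_simps)
  moreover have "L \<in> bounded_maps" "\<phi>\<^sub>2 \<in> bounded_maps"
    using \<open>L \<in> Dis_infty\<close> \<phi>(2) by (auto simp: Dis_infty_def coCP_def)
  ultimately show ?thesis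
    using \<phi>(2) by blast
qed

end
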